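(* Let $H$ and $H_1,\dots,H_m$ be finite-dimensional Hilbert spaces and let $\{V_j\}_{j=1}^m$ and $\{W_j\}_{j=1}^m$, with $V_j,W_j\in B(H,H_j)$, be two (OPV)-frames for $H$ which are similar. If $\{W_j\}_{j=1}^m$ is an equal-norm tight (OPV)-frame, then $\{V_jS^{-\frac12}\}_{j=1}^m$ is an equal-norm Parseval (OPV)-frame, where $S$ is the frame operator for $\{V_j\}_{j=1}^m$.
   Context: Hilbert spaces are over $\mathbb{R}$ or $\mathbb{C}$. A family $V_j\in B(H,H_j)$, $j=1,\dots,m$, is an operator-valued frame ((OPV)-frame) for $H$ if there are constants $A,B>0$ with $AI\le\sum_{j=1}^m V_j^*V_j\le BI$; its frame operator is $S=\sum_{j=1}^m V_j^*V_j$. It is tight with frame bound $A>0$ if $S=AI$, and Parseval if $S=I$. It is equal-norm if there is $c>0$ with $\|V_j\|_F=c$ for all $j$, where $\|\cdot\|_F$ is the Hilbert–Schmidt (Frobenius) norm. Two (OPV)-frames $\{U_j\}_{j=1}^m$ and $\{V_j\}_{j=1}^m$ are similar if there is an invertible (onto) operator $T$ on $H$ with $U_j=V_jT$ for $j=1,\dots,m$. *)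

theory Defs
  imports Complex_Main
begin

text \<open>The two scalar fields: up to isomorphism, the only instances of this class are the real
  and the complex numbers.\<close>

class real_or_complex = real_field +
  fixes to_complex :: "'a \<Rightarrow> complex"
  assumes to_complex_add: "to_complex (x + y) = to_complex x + to_complex y"
    and to_complex_mult: "to_complex (x * y) = to_complex x * to_complex y"
    and to_complex_one: "to_complex 1 = 1"
    and to_complex_scaleR: "to_complex (r *\<^sub>R x) = r *\<^sub>R to_complex x"
    and range_to_complex: "range to_complex = \<real> \<or> range to_complex = UNIV"

instantiation real :: real_or_complex
begin
definition to_complex_real :: "real \<Rightarrow> complex"
  where "to_complex_real x = complex_of_real x"
instance
  by standard (simp_all add: to_complex_real_def Reals_def fun_eq_iff image_def scaleR_conv_of_real)
end

instantiation complex :: real_or_complex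
begin
definition to_complex_complex :: "complex \<Rightarrow> complex"
  where "to_complex_complex x = x"
instance
  by standard (simp_all add: to_complex_complex_def image_def)
end

text \<open>A finite-dimensional Hilbert space with underlying set \<open>X\<close>, a linear subspace of an
  otherwise irrelevant vector space.  This allows a family \<open>H\<^sub>1, \<dots>, H\<^sub>m\<close> of different
  spaces to live in one type: any finite family of vector spaces embeds linearly in its direct
  sum, and each member carries its own inner product.  The inner product is linear in the first
  argument.  Completeness is automatic in finite dimension.\<close>

definition fd_hilbert_space ::
    "('k::real_or_complex \<Rightarrow> 'v::ab_group_add \<Rightarrow> 'v) \<Rightarrow> 'v set \<Rightarrow> ('v \<Rightarrow> 'v \<Rightarrow> 'k) \<Rightarrow> bool"
  where "fd_hilbert_space s X ip \<longleftrightarrow>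
    vector_space s \<and> (\<exists>B. finite B \<and> X = module.span s B) \<and>
    (\<forall>x\<in>X. \<forall>y\<in>X. \<forall>z\<in>X. ip (x + y) z = ip x z + ip y z) \<and>
    (\<forall>a. \<forall>x\<in>X. \<forall>y\<in>X. ip (s a x) y = a * ip x y) \<and>
    (\<forall>x\<in>X. \<forall>y\<in>X. to_complex (ip y x) = cnj (to_complex (ip x y))) \<and>
    (\<forall>x\<in>X. x \<noteq> 0 \<longrightarrow> Re (to_complex (ip x x)) > 0)"

definition ip_norm :: "('v \<Rightarrow> 'v \<Rightarrow> 'k::real_or_complex) \<Rightarrow> 'v \<Rightarrow> real"
  where "ip_norm ip x = sqrt (Re (to_complex (ip x x)))"

text \<open>From here on the domain Hilbert space \<open>H\<close> (scalar multiplication \<open>s\<close>, inner product \<open>ip\<close>)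
  occupies a whole type, while a codomain has scalar multiplication \<open>t\<close>, underlying set \<open>Y\<close> and
  inner product \<open>iq\<close>.\<close>

definition bounded_op ::
    "('k::real_or_complex \<Rightarrow> 'h::ab_group_add \<Rightarrow> 'h) \<Rightarrow> ('h \<Rightarrow> 'h \<Rightarrow> 'k) \<Rightarrow>
     ('k \<Rightarrow> 'g::ab_group_add \<Rightarrow> 'g) \<Rightarrow> 'g set \<Rightarrow> ('g \<Rightarrow> 'g \<Rightarrow> 'k) \<Rightarrow> ('h \<Rightarrow> 'g) \<Rightarrow> bool"
  where "bounded_op s ip t Y iq f \<longleftrightarrow>
    Vector_Spaces.linear s t f \<and> range f \<subseteq> Y \<and>
    (\<exists>C. \<forall>x. ip_norm iq (f x) \<le> C * ip_norm ip x)"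

text \<open>The adjoint is meaningful only at points \<open>y\<close> of the codomain \<open>Y\<close>.\<close>

definition adj_op ::
    "('h \<Rightarrow> 'h \<Rightarrow> 'k) \<Rightarrow> ('g \<Rightarrow> 'g \<Rightarrow> 'k) \<Rightarrow> ('h \<Rightarrow> 'g) \<Rightarrow> 'g \<Rightarrow> 'h"
  where "adj_op ip iq f y = (THE x. \<forall>z. ip z x = iq (f z) y)"

text \<open>Self-adjointness is required explicitly, since over the reals it does not follow from
  nonnegativity of the quadratic form.\<close>

definition positive_op ::
    "('k::real_or_complex \<Rightarrow> 'h::ab_group_add \<Rightarrow> 'h) \<Rightarrow> ('h \<Rightarrow> 'h \<Rightarrow> 'k) \<Rightarrow> ('h \<Rightarrow> 'h) \<Rightarrow> bool"
  where "positive_op s ip P \<longleftrightarrow>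
    bounded_op s ip s UNIV ip P \<and>
    (\<forall>x y. ip (P x) y = ip x (P y)) \<and>
    (\<forall>x. Re (to_complex (ip (P x) x)) \<ge> 0)"

definition op_le ::
    "('k::real_or_complex \<Rightarrow> 'h::ab_group_add \<Rightarrow> 'h) \<Rightarrow> ('h \<Rightarrow> 'h \<Rightarrow> 'k) \<Rightarrow>
     ('h \<Rightarrow> 'h) \<Rightarrow> ('h \<Rightarrow> 'h) \<Rightarrow> bool"
  where "op_le s ip P Q \<longleftrightarrow> positive_op s ip (\<lambda>x. Q x - P x)"

definition sqrt_op ::
    "('k::real_or_complex \<Rightarrow> 'h::ab_group_add \<Rightarrow> 'h) \<Rightarrow> ('h \<Rightarrow> 'h \<Rightarrow> 'k) \<Rightarrow> ('h \<Rightarrow> 'h) \<Rightarrow> 'h \<Rightarrow> 'h"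
  where "sqrt_op s ip P = (THE R. positive_op s ip R \<and> R \<circ> R = P)"

definition inv_sqrt_op ::
    "('k::real_or_complex \<Rightarrow> 'h::ab_group_add \<Rightarrow> 'h) \<Rightarrow> ('h \<Rightarrow> 'h \<Rightarrow> 'k) \<Rightarrow> ('h \<Rightarrow> 'h) \<Rightarrow> 'h \<Rightarrow> 'h"
  where "inv_sqrt_op s ip P = sqrt_op s ip (inv P)"

definition orthonormal_basis ::
    "('k::real_or_complex \<Rightarrow> 'h::ab_group_add \<Rightarrow> 'h) \<Rightarrow> ('h \<Rightarrow> 'h \<Rightarrow> 'k) \<Rightarrow> 'h set \<Rightarrow> bool"
  where "orthonormal_basis s ip E \<longleftrightarrow>
    finite E \<and> (\<forall>e\<in>E. \<forall>f\<in>E. ip e f = (if e = f then 1 else 0)) \<and> module.span s E = UNIV"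

text \<open>The Hilbert--Schmidt norm does not depend on the orthonormal basis chosen.\<close>

definition hs_norm ::
    "('k::real_or_complex \<Rightarrow> 'h::ab_group_add \<Rightarrow> 'h) \<Rightarrow> ('h \<Rightarrow> 'h \<Rightarrow> 'k) \<Rightarrow>
     ('g \<Rightarrow> 'g \<Rightarrow> 'k) \<Rightarrow> ('h \<Rightarrow> 'g) \<Rightarrow> real"
  where "hs_norm s ip iq f =
    sqrt (\<Sum>e\<in>(SOME E. orthonormal_basis s ip E). (ip_norm iq (f e))\<^sup>2)"

definition frame_op ::
    "('h::ab_group_add \<Rightarrow> 'h \<Rightarrow> 'k) \<Rightarrow> (nat \<Rightarrow> 'g \<Rightarrow> 'g \<Rightarrow> 'k) \<Rightarrow> nat \<Rightarrow> (nat \<Rightarrow> 'h \<Rightarrow> 'g) \<Rightarrow> 'h \<Rightarrow> 'h"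
  where "frame_op ip iq m V = (\<lambda>x. \<Sum>j = 1..m. adj_op ip (iq j) (V j) (V j x))"

definition opv_frame ::
    "('k::real_or_complex \<Rightarrow> 'h::ab_group_add \<Rightarrow> 'h) \<Rightarrow> ('h \<Rightarrow> 'h \<Rightarrow> 'k) \<Rightarrow>
     ('k \<Rightarrow> 'g::ab_group_add \<Rightarrow> 'g) \<Rightarrow> (nat \<Rightarrow> 'g set) \<Rightarrow> (nat \<Rightarrow> 'g \<Rightarrow> 'g \<Rightarrow> 'k) \<Rightarrow>
     nat \<Rightarrow> (nat \<Rightarrow> 'h \<Rightarrow> 'g) \<Rightarrow> bool"
  where "opv_frame s ip t K iq m V \<longleftrightarrow>
    (\<forall>j\<in>{1..m}. bounded_op s ip t (K j) (iq j) (V j)) \<and>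
    (\<exists>A>0. \<exists>B>0. op_le s ip (s (of_real A)) (frame_op ip iq m V) \<and>
                 op_le s ip (frame_op ip iq m V) (s (of_real B)))"

definition tight_opv_frame ::
    "('k::real_or_complex \<Rightarrow> 'h::ab_group_add \<Rightarrow> 'h) \<Rightarrow> ('h \<Rightarrow> 'h \<Rightarrow> 'k) \<Rightarrow>
     ('k \<Rightarrow> 'g::ab_group_add \<Rightarrow> 'g) \<Rightarrow> (nat \<Rightarrow> 'g set) \<Rightarrow> (nat \<Rightarrow> 'g \<Rightarrow> 'g \<Rightarrow> 'k) \<Rightarrow>
     nat \<Rightarrow> (nat \<Rightarrow> 'h \<Rightarrow> 'g) \<Rightarrow> bool"
  where "tight_opv_frame s ip t K iq m V \<longleftrightarrow>
    opv_frame s ip t K iq m V \<and> (\<exists>A>0. frame_op ip iq m V = s (of_real A))"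

definition parseval_opv_frame ::
    "('k::real_or_complex \<Rightarrow> 'h::ab_group_add \<Rightarrow> 'h) \<Rightarrow> ('h \<Rightarrow> 'h \<Rightarrow> 'k) \<Rightarrow>
     ('k \<Rightarrow> 'g::ab_group_add \<Rightarrow> 'g) \<Rightarrow> (nat \<Rightarrow> 'g set) \<Rightarrow> (nat \<Rightarrow> 'g \<Rightarrow> 'g \<Rightarrow> 'k) \<Rightarrow>
     nat \<Rightarrow> (nat \<Rightarrow> 'h \<Rightarrow> 'g) \<Rightarrow> bool"
  where "parseval_opv_frame s ip t K iq m V \<longleftrightarrow>
    opv_frame s ip t K iq m V \<and> frame_op ip iq m V = id"

definition equal_norm ::
    "('k::real_or_complex \<Rightarrow> 'h::ab_group_add \<Rightarrow> 'h) \<Rightarrow> ('h \<Rightarrow> 'h \<Rightarrow> 'k) \<Rightarrow>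
     (nat \<Rightarrow> 'g \<Rightarrow> 'g \<Rightarrow> 'k) \<Rightarrow> nat \<Rightarrow> (nat \<Rightarrow> 'h \<Rightarrow> 'g) \<Rightarrow> bool"
  where "equal_norm s ip iq m V \<longleftrightarrow> (\<exists>c>0. \<forall>j\<in>{1..m}. hs_norm s ip (iq j) (V j) = c)"

definition invertible_op ::
    "('k::real_or_complex \<Rightarrow> 'h::ab_group_add \<Rightarrow> 'h) \<Rightarrow> ('h \<Rightarrow> 'h \<Rightarrow> 'k) \<Rightarrow> ('h \<Rightarrow> 'h) \<Rightarrow> bool"
  where "invertible_op s ip T \<longleftrightarrow>
    bounded_op s ip s UNIV ip T \<and>
    (\<exists>T'. bounded_op s ip s UNIV ip T' \<and> T \<circ> T' = id \<and> T' \<circ> T = id)"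

definition similar_opv ::
    "('k::real_or_complex \<Rightarrow> 'h::ab_group_add \<Rightarrow> 'h) \<Rightarrow> ('h \<Rightarrow> 'h \<Rightarrow> 'k) \<Rightarrow> nat \<Rightarrow>
     (nat \<Rightarrow> 'h \<Rightarrow> 'g) \<Rightarrow> (nat \<Rightarrow> 'h \<Rightarrow> 'g) \<Rightarrow> bool"
  where "similar_opv s ip m U V \<longleftrightarrow>
    (\<exists>T. invertible_op s ip T \<and> (\<forall>j\<in>{1..m}. U j = V j \<circ> T))"

end

theory Submission
  imports Defs "HOL-Computational_Algebra.Fundamental_Theorem_Algebra"
begin

text \<open>Write \<open>V\<^sub>j = W\<^sub>j T\<close> and let \<open>A\<close> be the frame bound of the tight frame \<open>W\<close>, so that
  \<open>S = A T\<^sup>* T\<close>.  With \<open>R = S\<^sup>-\<^sup>1\<^sup>/\<^sup>2\<close> one has \<open>R S R = I\<close>, which gives the Parseval property and shows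
  that \<open>U = \<surd>A T R\<close> is unitary.  Since \<open>V\<^sub>j R = W\<^sub>j U / \<surd>A\<close> and the Hilbert--Schmidt norm is
  unitarily invariant, all the norms are \<open>\<parallel>W\<^sub>j\<parallel>\<^sub>F / \<surd>A\<close>.

  The square root of a positive operator \<open>P\<close> is obtained without diagonalization: \<open>P\<close> is annihilated
  by \<open>\<Prod>\<^sub>a (X - a)\<close> for finitely many distinct reals \<open>a \<ge> 0\<close>, and if a real polynomial \<open>r\<close>
  interpolates the fourth roots of these \<open>a\<close>, then \<open>r(P)\<^sup>2\<close> is a positive square root of \<open>P\<close>.\<close>

section \<open>Scalars and real polynomials\<close>

lemma to_complex_0 [simp]: "to_complex 0 = 0"
  using to_complex_add[of 0 0] by simp

lemma to_complex_diff: "to_complex (a - b) = to_complex a - to_complex b"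
  using to_complex_add[of "a - b" b] by simp

lemma to_complex_minus: "to_complex (- a) = - to_complex a"
  using to_complex_diff[of 0 a] by simp

lemma to_complex_of_real [simp]: "to_complex (of_real r) = of_real r"
  by (metis of_real_def to_complex_one to_complex_scaleR)

lemma to_complex_eq_0_iff [simp]: "to_complex a = 0 \<longleftrightarrow> a = 0"
proof
  assume "to_complex a = 0"
  then have "to_complex (a * inverse a) = 0"
    by (simp add: to_complex_mult)
  then show "a = 0"
    by (metis right_inverse to_complex_one zero_neq_one)
qed simp

lemma to_complex_eq_iff [simp]: "to_complex a = to_complex b \<longleftrightarrow> a = b"
  by (metis eq_iff_diff_eq_0 to_complex_diff to_complex_eq_0_iff)

text \<open>\<open>i\<close> is a preimage of the imaginary unit in the complex case and 0 in the
  real case. The lemma turns a finite spanning set over \<open>'k\<close> into a finite spanning set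
  over the reals.\<close>

lemma scalar_decomposition:
  "\<exists>i::'k::real_or_complex. \<forall>c::'k. \<exists>a b. c = of_real a + of_real b * i"
proof (cases "range (to_complex :: 'k \<Rightarrow> complex) = UNIV")
  case True
  then obtain i :: 'k where i: "to_complex i = \<i>"
    by (metis UNIV_I imageE)
  have "c = of_real (Re (to_complex c)) + of_real (Im (to_complex c)) * i" for c :: 'k
    by (subst to_complex_eq_iff[symmetric])
      (simp add: to_complex_add to_complex_mult i complex_eq_iff)
  then show ?thesis by blast
next
  case False
  then have *: "range (to_complex :: 'k \<Rightarrow> complex) = \<real>"
    using range_to_complex[where 'a='k] by blast
  have "\<exists>a. c = of_real a + of_real 0 * 0" for c :: 'k
  proof -
    obtain r where "to_complex c = of_real r"
      using * by (metis Reals_cases rangeI)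
    then have "to_complex c = to_complex (of_real r :: 'k)" by simp
    then show ?thesis by (metis add.right_neutral mult_zero_right to_complex_eq_iff)
  qed
  then show ?thesis by metis
qed

section \<open>Factorization and interpolation of real polynomials\<close>

lemma map_poly_of_real_mult:
  "map_poly complex_of_real (p * q) = map_poly of_real p * map_poly of_real q"
  by (rule poly_eqI) (simp add: coeff_map_poly coeff_mult)

lemma map_poly_of_real_add:
  "map_poly complex_of_real (p + q) = map_poly of_real p + map_poly of_real q"
  by (rule poly_eqI) (simp add: coeff_map_poly)

lemma poly_map_poly_of_real:
  "poly (map_poly complex_of_real p) (of_real x) = of_real (poly p x)"
  by (induction p) (simp_all add: map_poly_pCons)

text \<open>The fundamental theorem of algebra gives a complex root z. A real z splits off a linear
  factor; otherwise (X - Re z)^2 + (Im z)^2 divides p. The quadratic is kept as a sum of squares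
  because that form makes it injective at a self-adjoint operator.\<close>

lemma real_poly_factor:
  fixes p :: "real poly"
  assumes "degree p > 0"
  obtains a q where "p = [:-a, 1:] * q"
  | a b q where "b \<noteq> 0" "p = ([:-a, 1:] * [:-a, 1:] + [:b\<^sup>2:]) * q"
proof -
  let ?e = "\<lambda>p. poly (map_poly complex_of_real p)"
  have "\<not> constant (poly (map_poly complex_of_real p))"
    using assms by (simp add: constant_degree degree_map_poly)
  then obtain z where z: "?e p z = 0"
    using fundamental_theorem_of_algebra by blast
  show thesis
  proof (cases "Im z = 0")
    case True
    then have "z = complex_of_real (Re z)" by (simp add: complex_eq_iff)
    then have "complex_of_real (poly p (Re z)) = 0"
      using z by (metis poly_map_poly_of_real)
    then show thesis
      using that(1) by (metis dvdE of_real_eq_0_iff poly_eq_0_iff_dvd)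
  next
    case False
    let ?Q = "[:- Re z, 1:] * [:- Re z, 1:] + [:(Im z)\<^sup>2:]"
    have Q: "?Q = [:(Re z)\<^sup>2 + (Im z)\<^sup>2, - 2 * Re z, 1:]"
      by (simp add: power2_eq_square)
    have "?e ?Q z = 0"
      unfolding Q by (simp add: map_poly_pCons complex_eq_iff power2_eq_square algebra_simps)
    moreover have "?e p z = ?e ?Q z * ?e (p div ?Q) z + ?e (p mod ?Q) z"
      by (metis map_poly_of_real_add map_poly_of_real_mult mult_div_mod_eq poly_add poly_mult)
    ultimately have z': "?e (p mod ?Q) z = 0"
      using z by simp
    \<comment> \<open>The remainder c + d X has real coefficients and vanishes at the nonreal z: the
      imaginary part gives d = 0, and then c = 0.\<close>
    have "p mod ?Q = 0"
    proof (rule ccontr)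
      assume nz: "p mod ?Q \<noteq> 0"
      then have "degree (p mod ?Q) < degree ?Q"
        using degree_mod_less'[of ?Q p] unfolding Q by simp
      then have "degree (p mod ?Q) \<le> 1" unfolding Q by simp
      moreover obtain c r where r: "p mod ?Q = pCons c r"
        by (rule pCons_cases)
      ultimately have "degree r = 0"
        by (simp split: if_splits)
      then obtain d where cd: "p mod ?Q = [:c, d:]"
        using r by (metis degree_eq_zeroE)
      have "d = 0" "c = 0"
        using z' False unfolding cd by (auto simp: map_poly_pCons complex_eq_iff)
      then show False using nz cd by simp
    qed
    then have "?Q dvd p" by (simp add: dvd_eq_mod_eq_0)
    then show thesis using that(2) False by (metis dvdE)
  qed
qed

lemma prod_linear_dvd:
  fixes p :: "'a::field poly"
  assumes "finite A" and "\<And>a. a \<in> A \<Longrightarrow> poly p a = 0"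
  shows "(\<Prod>a\<in>A. [:-a, 1:]) dvd p"
  using assms
proof (induction A rule: finite_induct)
  case (insert b A)
  then obtain g where g: "p = (\<Prod>a\<in>A. [:-a, 1:]) * g" by auto
  have "poly (\<Prod>a\<in>A. [:-a, 1:]) b \<noteq> 0"
    using insert by (auto simp: poly_prod)
  then have "poly g b = 0"
    using insert.prems[of b] g by simp
  then have "[:-b, 1:] dvd g" by (simp add: poly_eq_0_iff_dvd)
  then show ?case
    using insert.hyps unfolding g by (simp add: mult.commute mult_dvd_mono del: mult_pCons_left mult_pCons_right)
qed simp

text \<open>Newton interpolation: a new node b is handled by adding a multiple of a product that
  vanishes at all old nodes but not at b.\<close>

lemma interpolation_poly:
  fixes f :: "'a::field \<Rightarrow> 'a"
  assumes "finite A"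
  shows "\<exists>q. \<forall>a\<in>A. poly q a = f a"
  using assms
proof (induction A rule: finite_induct)
  case (insert b A)
  then obtain q where q: "\<forall>a\<in>A. poly q a = f a" by auto
  let ?w = "\<Prod>a\<in>A. [:-a, 1:]"
  have w: "poly ?w b \<noteq> 0"
    using insert by (auto simp: poly_prod)
  have "poly ?w a = 0" if "a \<in> A" for a
    using that insert by (auto simp: poly_prod)
  then have "\<forall>a\<in>insert b A. poly (q + smult ((f b - poly q b) / poly ?w b) ?w) a = f a"
    using q w by auto
  then show ?case by blast
qed simp

section \<open>Finite-dimensional Hilbert spaces\<close>

locale fd_hilbert =
  fixes s :: "'k::real_or_complex \<Rightarrow> 'v::ab_group_add \<Rightarrow> 'v" and X ip
  assumes fd_hilbert: "fd_hilbert_space s X ip"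
begin

sublocale vector_space s
  using fd_hilbert by (simp add: fd_hilbert_space_def)

text \<open>Computing in the complex numbers makes \<open>cnj\<close> and \<open>Re\<close>
  available for both scalar fields at once; injectivity of \<open>to_complex\<close> carries
  equations back to \<open>ip\<close>.\<close>

abbreviation inn :: "'v \<Rightarrow> 'v \<Rightarrow> complex" where
  "inn x y \<equiv> to_complex (ip x y)"

lemma finite_spanning: "\<exists>B. finite B \<and> X = span B"
  using fd_hilbert by (simp add: fd_hilbert_space_def)

lemma subspace_carrier: "subspace X"
  using finite_spanning by auto

lemma ip_add_left: "x \<in> X \<Longrightarrow> y \<in> X \<Longrightarrow> z \<in> X \<Longrightarrow> ip (x + y) z = ip x z + ip y z"
  and ip_scale_left: "x \<in> X \<Longrightarrow> y \<in> X \<Longrightarrow> ip (s a x) y = a * ip x y"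
  and inn_commute: "x \<in> X \<Longrightarrow> y \<in> X \<Longrightarrow> inn y x = cnj (inn x y)"
  and inn_pos: "x \<in> X \<Longrightarrow> x \<noteq> 0 \<Longrightarrow> Re (inn x x) > 0"
  using fd_hilbert unfolding fd_hilbert_space_def by blast+

lemma inn_add_left: "x \<in> X \<Longrightarrow> y \<in> X \<Longrightarrow> z \<in> X \<Longrightarrow> inn (x + y) z = inn x z + inn y z"
  by (simp add: ip_add_left to_complex_add)

lemma inn_scale_left: "x \<in> X \<Longrightarrow> y \<in> X \<Longrightarrow> inn (s a x) y = to_complex a * inn x y"
  by (simp add: ip_scale_left to_complex_mult)

lemma inn_add_right: "x \<in> X \<Longrightarrow> y \<in> X \<Longrightarrow> z \<in> X \<Longrightarrow> inn z (x + y) = inn z x + inn z y"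
  using inn_commute[of "x + y" z] inn_commute[of x z] inn_commute[of y z]
  by (simp add: inn_add_left subspace_add[OF subspace_carrier])

lemma inn_scale_right: "x \<in> X \<Longrightarrow> y \<in> X \<Longrightarrow> inn y (s a x) = cnj (to_complex a) * inn y x"
  using inn_commute[of "s a x" y] inn_commute[of x y]
  by (simp add: inn_scale_left subspace_scale[OF subspace_carrier])

lemma inn_minus_left: "x \<in> X \<Longrightarrow> y \<in> X \<Longrightarrow> inn (- x) y = - inn x y"
  using inn_scale_left[of x y "- 1"] by (simp add: to_complex_minus to_complex_one)

lemma inn_minus_right: "x \<in> X \<Longrightarrow> y \<in> X \<Longrightarrow> inn y (- x) = - inn y x"
  using inn_scale_right[of x y "- 1"] by (simp add: to_complex_minus to_complex_one)

lemma inn_diff_left: "x \<in> X \<Longrightarrow> y \<in> X \<Longrightarrow> z \<in> X \<Longrightarrow> inn (x - y) z = inn x z - inn y z"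
  using inn_add_left[of x "- y" z] by (simp add: inn_minus_left subspace_neg[OF subspace_carrier])

lemma inn_diff_right: "x \<in> X \<Longrightarrow> y \<in> X \<Longrightarrow> z \<in> X \<Longrightarrow> inn z (x - y) = inn z x - inn z y"
  using inn_add_right[of x "- y" z] by (simp add: inn_minus_right subspace_neg[OF subspace_carrier])

lemma inn_zero_left [simp]: "y \<in> X \<Longrightarrow> inn 0 y = 0"
  using inn_scale_left[of 0 y 0] subspace_0[OF subspace_carrier] by simp

lemma inn_zero_right [simp]: "y \<in> X \<Longrightarrow> inn y 0 = 0"
  using inn_scale_right[of 0 y 0] subspace_0[OF subspace_carrier] by simp

lemma inn_self_nonneg: "x \<in> X \<Longrightarrow> Re (inn x x) \<ge> 0"
  using inn_pos[of x] by (cases "x = 0") auto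

lemma inn_self_eq_0: "x \<in> X \<Longrightarrow> Re (inn x x) = 0 \<longleftrightarrow> x = 0"
  using inn_pos[of x] by (cases "x = 0") auto

lemma inn_self_real: "x \<in> X \<Longrightarrow> inn x x = of_real (Re (inn x x))"
  using inn_commute[of x x] by (simp add: complex_eq_iff)

lemma inn_sum_left:
  "(\<And>i. i \<in> I \<Longrightarrow> f i \<in> X) \<Longrightarrow> y \<in> X \<Longrightarrow> inn (sum f I) y = (\<Sum>i\<in>I. inn (f i) y)"
  by (induction I rule: infinite_finite_induct)
    (simp_all add: inn_add_left subspace_sum[OF subspace_carrier])

lemma inn_sum_right:
  "(\<And>i. i \<in> I \<Longrightarrow> f i \<in> X) \<Longrightarrow> y \<in> X \<Longrightarrow> inn y (sum f I) = (\<Sum>i\<in>I. inn y (f i))"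
  by (induction I rule: infinite_finite_induct)
    (simp_all add: inn_add_right subspace_sum[OF subspace_carrier])

lemma ip_norm_nonneg: "x \<in> X \<Longrightarrow> ip_norm ip x \<ge> 0"
  by (simp add: ip_norm_def inn_self_nonneg)

lemma ip_norm_sq: "x \<in> X \<Longrightarrow> (ip_norm ip x)\<^sup>2 = Re (inn x x)"
  by (simp add: ip_norm_def inn_self_nonneg)

lemma ip_norm_scale: "x \<in> X \<Longrightarrow> ip_norm ip (s a x) = cmod (to_complex a) * ip_norm ip x"
proof -
  assume x: "x \<in> X"
  then have "inn (s a x) (s a x) = of_real ((cmod (to_complex a))\<^sup>2 * Re (inn x x))"
    using complex_norm_square[of "to_complex a"] inn_self_real[OF x]
    by (simp add: inn_scale_left inn_scale_right subspace_scale[OF subspace_carrier])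
  then have "Re (inn (s a x) (s a x)) = (cmod (to_complex a))\<^sup>2 * Re (inn x x)"
    by simp
  then show ?thesis
    by (simp add: ip_norm_def real_sqrt_mult)
qed

text \<open>Parallelogram law with the term for x - y dropped. This crude bound suffices for
  boundedness and avoids the Cauchy-Schwarz inequality.\<close>

lemma ip_norm_add_sq_le:
  assumes "x \<in> X" "y \<in> X"
  shows "(ip_norm ip (x + y))\<^sup>2 \<le> 2 * (ip_norm ip x)\<^sup>2 + 2 * (ip_norm ip y)\<^sup>2"
proof -
  have "Re (inn (x - y) (x - y)) \<ge> 0"
    using assms by (simp add: inn_self_nonneg subspace_diff[OF subspace_carrier])
  then show ?thesis
    using assms
    by (simp add: ip_norm_sq inn_add_left inn_add_right inn_diff_left inn_diff_right
        subspace_add[OF subspace_carrier] subspace_diff[OF subspace_carrier])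
qed

lemma ip_norm_sum_sq_le:
  assumes "finite I" "\<And>i. i \<in> I \<Longrightarrow> f i \<in> X"
  shows "(ip_norm ip (sum f I))\<^sup>2 \<le> 2 ^ card I * (\<Sum>i\<in>I. (ip_norm ip (f i))\<^sup>2)"
  using assms
proof (induction I rule: finite_induct)
  case empty
  then show ?case by (simp add: ip_norm_def subspace_0[OF subspace_carrier])
next
  case (insert i I)
  let ?S = "\<Sum>i\<in>I. (ip_norm ip (f i))\<^sup>2"
  have "(ip_norm ip (sum f (insert i I)))\<^sup>2
      \<le> 2 * (ip_norm ip (f i))\<^sup>2 + 2 * (ip_norm ip (sum f I))\<^sup>2"
    using insert by (simp add: ip_norm_add_sq_le subspace_sum[OF subspace_carrier])
  also have "\<dots> \<le> 2 * 2 ^ card I * (ip_norm ip (f i))\<^sup>2 + 2 * (2 ^ card I * ?S)"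
    using insert by (intro add_mono mult_mono) auto
  also have "\<dots> = 2 ^ card (insert i I) * (\<Sum>i\<in>insert i I. (ip_norm ip (f i))\<^sup>2)"
    using insert by (simp add: algebra_simps)
  finally show ?case .
qed

text \<open>Gram-Schmidt, one vector of B at a time; a vector already in the span of E adds
  nothing.\<close>

lemma exists_orthonormal_span:
  assumes "finite B" "B \<subseteq> X"
  shows "\<exists>E\<subseteq>X. finite E \<and> (\<forall>e\<in>E. \<forall>f\<in>E. ip e f = (if e = f then 1 else 0)) \<and> B \<subseteq> span E"
  using assms
proof (induction B rule: finite_induct)
  case empty
  then show ?case by (intro exI[of _ "{}"]) simp
next
  case (insert b B)
  then obtain E where E: "E \<subseteq> X" "finite E" "B \<subseteq> span E"
    and on: "\<And>e f. e \<in> E \<Longrightarrow> f \<in> E \<Longrightarrow> ip e f = (if e = f then 1 else 0)"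
    by auto
  have bX: "b \<in> X" using insert by auto
  \<comment> \<open>p is the orthogonal projection of b onto the span of E, so b - p is orthogonal
    to E and only has to be normalized.\<close>
  define p where "p = (\<Sum>e\<in>E. s (ip b e) e)"
  have p_span: "p \<in> span E"
    unfolding p_def by (intro span_sum span_scale span_base)
  have pX: "p \<in> X"
    unfolding p_def using E subspace_carrier by (intro subspace_sum subspace_scale) auto
  have dX: "b - p \<in> X"
    using bX pX by (intro subspace_diff[OF subspace_carrier])
  have orth: "inn (b - p) f = 0" if f: "f \<in> E" for f
  proof -
    have "inn p f = (\<Sum>e\<in>E. inn b e * inn e f)"
      unfolding p_def using E f
      by (subst inn_sum_left) (auto simp: inn_scale_left subspace_scale[OF subspace_carrier]
          subset_iff intro!: sum.cong)
    also have "\<dots> = (\<Sum>e\<in>E. if e = f then inn b e else 0)"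
      using f by (intro sum.cong) (auto simp: on to_complex_one)
    also have "\<dots> = inn b f"
      using f E by simp
    finally show ?thesis
      using f E bX pX inn_diff_left[of b p f] by auto
  qed
  show ?case
  proof (cases "b = p")
    case True
    then show ?thesis
      using E on p_span by (intro exI[of _ E]) auto
  next
    case False
    define n where "n = ip_norm ip (b - p)"
    have n: "n > 0"
      using inn_pos[OF dX] False by (simp add: n_def ip_norm_def)
    define a where "a = 1 / n"
    define e0 where "e0 = s (of_real a) (b - p)"
    have e0X: "e0 \<in> X"
      unfolding e0_def using dX by (intro subspace_scale[OF subspace_carrier])
    have "inn e0 e0 = 1"
    proof -
      have "inn (b - p) (b - p) = of_real (n\<^sup>2)"
        using inn_self_real[OF dX] by (simp add: n_def ip_norm_sq dX)
      moreover have "a * (a * n\<^sup>2) = 1"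
        using n by (simp add: a_def power2_eq_square)
      ultimately show ?thesis
        unfolding e0_def using dX
        by (simp add: inn_scale_left inn_scale_right subspace_scale[OF subspace_carrier]
            flip: of_real_mult of_real_power)
    qed
    then have e0_norm: "ip e0 e0 = 1"
      by (metis to_complex_eq_iff to_complex_one)
    have e0_orth: "ip e0 f = 0 \<and> ip f e0 = 0" if "f \<in> E" for f
    proof -
      have "inn e0 f = 0"
        unfolding e0_def using orth[OF that] dX that E by (auto simp: ip_scale_left)
      then show ?thesis
        using inn_commute[of e0 f] e0X that E by auto
    qed
    have "e0 \<notin> E"
      using e0_norm e0_orth[of e0] by auto
    moreover have "b \<in> span (insert e0 E)"
    proof -
      have "s (of_real n) e0 = b - p"
        using n by (simp add: e0_def a_def flip: of_real_mult)
      then have "b = s (of_real n) e0 + p" by simp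
      then show ?thesis
        using p_span span_mono[of E "insert e0 E"]
        by (metis insertI1 span_add span_base span_scale subset_insertI subset_iff)
    qed
    moreover have "B \<subseteq> span (insert e0 E)"
      using E(3) span_mono[of E "insert e0 E"] by blast
    ultimately show ?thesis
      using E e0X on e0_norm e0_orth by (intro exI[of _ "insert e0 E"]) auto
  qed
qed

end

section \<open>Orthonormal bases of a space that fills its type\<close>

locale fd_hilbert_UNIV = fd_hilbert s UNIV ip
  for s :: "'k::real_or_complex \<Rightarrow> 'v::ab_group_add \<Rightarrow> 'v" and ip
begin

lemmas inn_simps = inn_add_left[simplified] inn_add_right[simplified]
  inn_diff_left[simplified] inn_diff_right[simplified]
  inn_scale_left[simplified] inn_scale_right[simplified]

lemma inn_eqI:
  assumes "\<And>z. inn z x = inn z y"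
  shows "x = y"
  using inn_self_eq_0[of "x - y"] assms by (simp add: inn_simps)

lemma exists_orthonormal_basis: "\<exists>E. orthonormal_basis s ip E"
proof -
  obtain B where B: "finite B" "span B = UNIV"
    using finite_spanning by metis
  then obtain E where E: "finite E" "\<forall>e\<in>E. \<forall>f\<in>E. ip e f = (if e = f then 1 else 0)" "B \<subseteq> span E"
    using exists_orthonormal_span[of B] by auto
  then have "span B \<subseteq> span E"
    by (intro span_minimal) auto
  then have "span E = UNIV"
    using B by auto
  with E(1,2) show ?thesis
    unfolding orthonormal_basis_def by blast
qed

lemma orthonormal_expansion:
  assumes "orthonormal_basis s ip E"
  shows "x = (\<Sum>e\<in>E. s (ip x e) e)"
proof -
  have E: "finite E" "span E = UNIV"
    and on: "\<And>e f. e \<in> E \<Longrightarrow> f \<in> E \<Longrightarrow> ip e f = (if e = f then 1 else 0)"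
    using assms by (auto simp: orthonormal_basis_def)
  obtain u where u: "x = (\<Sum>e\<in>E. s (u e) e)"
    using E span_finite[of E] by auto
  have "ip x f = u f" if f: "f \<in> E" for f
  proof -
    have "inn x f = (\<Sum>e\<in>E. if e = f then to_complex (u e) else 0)"
      unfolding u using f
      by (subst inn_sum_left) (auto simp: inn_simps on to_complex_one intro!: sum.cong)
    also have "\<dots> = to_complex (u f)"
      using f E by simp
    finally show ?thesis by simp
  qed
  then have "(\<Sum>e\<in>E. s (ip x e) e) = (\<Sum>e\<in>E. s (u e) e)"
    by (intro sum.cong) auto
  then show ?thesis by (rule trans[OF u sym])
qed

lemma parseval:
  assumes "orthonormal_basis s ip E"
  shows "inn x y = (\<Sum>e\<in>E. inn x e * inn e y)"
proof -
  have "inn x y = inn (\<Sum>e\<in>E. s (ip x e) e) y"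
    using orthonormal_expansion[OF assms, of x] by (rule arg_cong)
  also have "\<dots> = (\<Sum>e\<in>E. inn x e * inn e y)"
    by (simp add: inn_sum_left inn_simps)
  finally show ?thesis .
qed

text \<open>Preserving inner products makes U injective, and surjectivity makes the image span.
  Injectivity on E is recorded to reindex sums over the image.\<close>

lemma orthonormal_basis_image:
  assumes E: "orthonormal_basis s ip E"
    and U: "Vector_Spaces.linear s s U" "surj U" "\<And>x y. ip (U x) (U y) = ip x y"
  shows "orthonormal_basis s ip (U ` E)" and "inj_on U E"
proof -
  interpret U: Vector_Spaces.linear s s U by fact
  have "inj U"
  proof (rule injI)
    fix x y assume "U x = U y"
    then have "U (x - y) = 0" by (simp add: U.diff)
    then have "ip (x - y) (x - y) = ip 0 0"
      using U(3)[of "x - y" "x - y"] U(3)[of 0 0] by (simp only: U.zero)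
    then show "x = y"
      using inn_self_eq_0[of "x - y"] by simp
  qed
  then show "inj_on U E" by (rule inj_on_subset) simp
  show "orthonormal_basis s ip (U ` E)"
    unfolding orthonormal_basis_def
  proof (intro conjI ballI)
    show "finite (U ` E)" "span (U ` E) = UNIV"
      using E U(2) by (auto simp: orthonormal_basis_def U.span_image)
    fix x y assume "x \<in> U ` E" "y \<in> U ` E"
    then obtain e f where "e \<in> E" "f \<in> E" "x = U e" "y = U f" by blast
    then show "ip x y = (if x = y then 1 else 0)"
      using E \<open>inj U\<close> by (simp add: orthonormal_basis_def U(3) inj_eq)
  qed
qed

end

section \<open>Bounded operators and adjoints\<close>

lemma fd_hilbert_UNIV_iff: "fd_hilbert_UNIV s ip \<longleftrightarrow> fd_hilbert_space s UNIV ip"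
  by (simp add: fd_hilbert_UNIV_def fd_hilbert_def)

context fd_hilbert_UNIV
begin

text \<open>Expand x in an orthonormal basis: each coordinate is bounded by the norm of x, and
  finitely many terms remain. Boundedness of every operator constructed later is obtained this
  way.\<close>

lemma linear_imp_bounded_op:
  assumes "fd_hilbert_space t Y iq" "Vector_Spaces.linear s t f" "range f \<subseteq> Y"
  shows "bounded_op s ip t Y iq f"
proof -
  interpret Y: fd_hilbert t Y iq by unfold_locales fact
  interpret f: Vector_Spaces.linear s t f by fact
  obtain E where E: "orthonormal_basis s ip E"
    using exists_orthonormal_basis by blast
  then have fin: "finite E" by (simp add: orthonormal_basis_def)
  define C where "C = 2 ^ card E * (\<Sum>e\<in>E. (ip_norm iq (f e))\<^sup>2)"
  have fY: "f x \<in> Y" for x using assms(3) by auto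
  have "ip_norm iq (f x) \<le> sqrt C * ip_norm ip x" for x
  proof -
    \<comment> \<open>The left side is one of the nonnegative terms of Parseval's sum for x.\<close>
    have coord: "(cmod (inn x e))\<^sup>2 \<le> (ip_norm ip x)\<^sup>2" if "e \<in> E" for e
    proof -
      have "inn x x = of_real (\<Sum>e\<in>E. (cmod (inn x e))\<^sup>2)"
        unfolding parseval[OF E, of x x] of_real_sum
      proof (rule sum.cong)
        fix e
        show "inn x e * inn e x = of_real ((cmod (inn x e))\<^sup>2)"
          using complex_norm_square[of "inn x e"] inn_commute[of x e] by simp
      qed simp
      then have "(ip_norm ip x)\<^sup>2 = (\<Sum>e\<in>E. (cmod (inn x e))\<^sup>2)"
        by (simp add: ip_norm_sq)
      then show ?thesis
        using member_le_sum[of e E "\<lambda>e. (cmod (inn x e))\<^sup>2"] that fin by simp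
    qed
    have "f x = (\<Sum>e\<in>E. t (ip x e) (f e))"
      by (subst orthonormal_expansion[OF E]) (simp add: f.sum f.scale)
    then have "(ip_norm iq (f x))\<^sup>2 = (ip_norm iq (\<Sum>e\<in>E. t (ip x e) (f e)))\<^sup>2"
      by simp
    also have "\<dots> \<le> 2 ^ card E * (\<Sum>e\<in>E. (ip_norm iq (t (ip x e) (f e)))\<^sup>2)"
      using fin fY by (intro Y.ip_norm_sum_sq_le) (auto intro: Y.subspace_scale[OF Y.subspace_carrier])
    also have "\<dots> = 2 ^ card E * (\<Sum>e\<in>E. (cmod (inn x e))\<^sup>2 * (ip_norm iq (f e))\<^sup>2)"
      by (simp add: Y.ip_norm_scale fY power_mult_distrib)
    also have "\<dots> \<le> 2 ^ card E * (\<Sum>e\<in>E. (ip_norm ip x)\<^sup>2 * (ip_norm iq (f e))\<^sup>2)"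
      by (intro mult_left_mono sum_mono mult_right_mono coord) auto
    also have "\<dots> = C * (ip_norm ip x)\<^sup>2"
      by (simp add: C_def sum_distrib_left mult_ac)
    finally have "sqrt ((ip_norm iq (f x))\<^sup>2) \<le> sqrt (C * (ip_norm ip x)\<^sup>2)"
      by (rule real_sqrt_le_mono)
    then show ?thesis
      by (simp add: real_sqrt_mult Y.ip_norm_nonneg fY ip_norm_nonneg)
  qed
  then show ?thesis
    using assms unfolding bounded_op_def by blast
qed

text \<open>Existence comes from an explicit Riesz representative in an orthonormal basis,
  uniqueness from \<open>inn_eqI\<close>; together they justify the definite description.\<close>

lemma adj_op:
  assumes "fd_hilbert_space t Y iq" "Vector_Spaces.linear s t f" "range f \<subseteq> Y" "y \<in> Y"
  shows "ip z (adj_op ip iq f y) = iq (f z) y"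
proof -
  interpret Y: fd_hilbert t Y iq by unfold_locales fact
  interpret f: Vector_Spaces.linear s t f by fact
  obtain E where E: "orthonormal_basis s ip E"
    using exists_orthonormal_basis by blast
  have fY: "f x \<in> Y" for x using assms(3) by auto
  \<comment> \<open>The order \<open>iq y (f e)\<close> is forced: \<open>inn\<close> is
    conjugate-linear in its second argument, so this coefficient comes out as the inner product of f
    e with y.\<close>
  define a where "a = (\<Sum>e\<in>E. s (iq y (f e)) e)"
  have "ip z a = iq (f z) y" for z
  proof -
    have "Y.inn (f z) y = Y.inn (\<Sum>e\<in>E. t (ip z e) (f e)) y"
      by (subst orthonormal_expansion[OF E]) (simp add: f.sum f.scale)
    also have "\<dots> = (\<Sum>e\<in>E. inn z e * Y.inn (f e) y)"
      using assms(4) fY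
      by (simp add: Y.inn_sum_left Y.inn_scale_left Y.subspace_scale[OF Y.subspace_carrier])
    also have "\<dots> = (\<Sum>e\<in>E. inn z (s (iq y (f e)) e))"
    proof (rule sum.cong)
      fix e
      show "inn z e * Y.inn (f e) y = inn z (s (iq y (f e)) e)"
        using Y.inn_commute[OF assms(4) fY, of e] by (simp add: inn_simps)
    qed simp
    also have "\<dots> = inn z a"
      by (simp add: a_def inn_sum_right)
    finally show ?thesis by simp
  qed
  then have "\<exists>!x. \<forall>z. ip z x = iq (f z) y"
    by (metis inn_eqI)
  from theI'[OF this] show ?thesis
    unfolding adj_op_def by blast
qed

text \<open>Eliminates the adjoints: later computations with frame operators go through this
  sesquilinear form.\<close>

lemma frame_op:
  assumes "\<And>j. j \<in> {1..m} \<Longrightarrow> fd_hilbert_space t (K j) (iq j)"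
    and "\<And>j. j \<in> {1..m} \<Longrightarrow> bounded_op s ip t (K j) (iq j) (V j)"
  shows "inn z (frame_op ip iq m V x) = (\<Sum>j=1..m. to_complex (iq j (V j z) (V j x)))"
proof -
  have "ip z (adj_op ip (iq j) (V j) (V j x)) = iq j (V j z) (V j x)" if "j \<in> {1..m}" for j
    using assms(2)[OF that] by (intro adj_op[OF assms(1)[OF that]]) (auto simp: bounded_op_def)
  then show ?thesis
    by (simp add: frame_op_def inn_sum_right)
qed

section \<open>Trace and Hilbert-Schmidt norm\<close>

lemma self_adjoint_inn: "(\<And>x y. ip (G x) y = ip x (G y)) \<Longrightarrow> cnj (inn (G x) y) = inn (G y) x"
  using inn_commute[of "G x" y] by simp

text \<open>Since \<open>G\<close> is self-adjoint, both sides are the sum over \<open>e \<in> E\<close>, \<open>f \<in> F\<close> of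
  the numbers \<open>\<langle>G e, f\<rangle> \<langle>f, e\<rangle>\<close> or of their conjugates.\<close>

lemma trace_basis_independent:
  assumes "orthonormal_basis s ip E" "orthonormal_basis s ip F"
    and "\<And>x y. ip (G x) y = ip x (G y)"
  shows "(\<Sum>e\<in>E. Re (inn (G e) e)) = (\<Sum>f\<in>F. Re (inn (G f) f))"
proof -
  have "(\<Sum>e\<in>E. Re (inn (G e) e)) = (\<Sum>e\<in>E. \<Sum>f\<in>F. Re (inn (G e) f * inn f e))"
    by (subst parseval[OF assms(2)]) simp
  also have "\<dots> = (\<Sum>f\<in>F. \<Sum>e\<in>E. Re (inn (G e) f * inn f e))"
    by (rule sum.swap)
  also have "\<dots> = (\<Sum>f\<in>F. \<Sum>e\<in>E. Re (inn (G f) e * inn e f))"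
  proof (intro sum.cong refl)
    fix e f
    have "inn (G f) e * inn e f = cnj (inn (G e) f * inn f e)"
      using self_adjoint_inn[OF assms(3)] inn_commute[of f e] by simp
    then show "Re (inn (G e) f * inn f e) = Re (inn (G f) e * inn e f)"
      by simp
  qed
  also have "\<dots> = (\<Sum>f\<in>F. Re (inn (G f) f))"
    by (subst (2) parseval[OF assms(1)]) simp
  finally show ?thesis .
qed

text \<open>The squared norm is the trace of the self-adjoint operator G, the adjoint of f composed
  with f. Basis independence of the trace then replaces the basis picked by \<open>SOME\<close> with
  F.\<close>

lemma hs_norm_eq:
  assumes F: "orthonormal_basis s ip F"
    and "fd_hilbert_space t Y iq" "Vector_Spaces.linear s t f" "range f \<subseteq> Y"
  shows "hs_norm s ip iq f = sqrt (\<Sum>e\<in>F. (ip_norm iq (f e))\<^sup>2)"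
proof -
  interpret Y: fd_hilbert t Y iq by unfold_locales fact
  have fY: "f x \<in> Y" for x using assms(4) by auto
  define G where "G = (\<lambda>x. adj_op ip iq f (f x))"
  have G: "inn z (G x) = Y.inn (f z) (f x)" for x z
    using adj_op[OF assms(2-4) fY] by (simp add: G_def)
  have "inn (G x) z = inn x (G z)" for x z
    using inn_commute[of z "G x"] Y.inn_commute[OF fY fY, of x z] G[of z x] G[of x z] by simp
  then have sa: "ip (G x) z = ip x (G z)" for x z
    by simp
  have "(ip_norm iq (f e))\<^sup>2 = Re (inn (G e) e)" for e
    by (simp add: Y.ip_norm_sq fY sa G)
  then show ?thesis
    using trace_basis_independent[OF someI_ex[OF exists_orthonormal_basis] F sa]
    by (simp add: hs_norm_def)
qed

section \<open>Square roots of positive operators\<close>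

text \<open>Horner evaluation. The coefficients are real so that a polynomial in a self-adjoint
  operator is again self-adjoint, over either scalar field.\<close>

definition op_poly :: "('v \<Rightarrow> 'v) \<Rightarrow> real poly \<Rightarrow> 'v \<Rightarrow> 'v" where
  "op_poly P p x = fold_coeffs (\<lambda>a y. s (of_real a) x + P y) p 0"

end

section \<open>Real polynomials in a self-adjoint operator\<close>

locale self_adjoint = fd_hilbert_UNIV s ip + P: Vector_Spaces.linear s s P
  for s :: "'k::real_or_complex \<Rightarrow> 'v::ab_group_add \<Rightarrow> 'v" and ip P +
  assumes self_adjoint: "ip (P x) y = ip x (P y)"
begin

abbreviation pol :: "real poly \<Rightarrow> 'v \<Rightarrow> 'v" where
  "pol \<equiv> op_poly P"

lemma pol_0 [simp]: "pol 0 x = 0"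
  by (simp add: op_poly_def)

lemma pol_pCons [simp]: "pol (pCons a p) x = s (of_real a) x + P (pol p x)"
  by (cases "p = 0 \<and> a = 0") (auto simp: op_poly_def)

lemma pol_add: "pol (p + q) x = pol p x + pol q x"
  by (induction p q rule: poly_induct2) (simp_all add: P.add scale_left_distrib algebra_simps)

lemma pol_smult: "pol (smult c p) x = s (of_real c) (pol p x)"
  by (induction p) (simp_all add: P.scale scale_right_distrib)

lemma pol_add_arg: "pol p (x + y) = pol p x + pol p y"
  by (induction p) (simp_all add: P.add scale_right_distrib algebra_simps)

lemma pol_scale_arg: "pol p (s c x) = s c (pol p x)"
  by (induction p) (simp_all add: P.scale scale_right_distrib mult.commute)

lemma pol_zero_arg [simp]: "pol p 0 = 0"
  by (induction p) (simp_all add: P.zero)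

lemma linear_pol: "Vector_Spaces.linear s s (pol p)"
  by (simp add: Vector_Spaces.linear_iff vector_space_axioms pol_add_arg pol_scale_arg)

lemma pol_commute:
  assumes "Vector_Spaces.linear s s Q" "\<And>x. Q (P x) = P (Q x)"
  shows "Q (pol p x) = pol p (Q x)"
proof -
  interpret Q: Vector_Spaces.linear s s Q by fact
  show ?thesis
    by (induction p) (simp_all add: Q.add Q.scale assms(2))
qed

lemma pol_P: "P (pol p x) = pol p (P x)"
  by (rule pol_commute) (simp_all add: P.linear_axioms)

lemma pol_mult: "pol (p * q) x = pol p (pol q x)"
  by (induction p) (simp_all add: pol_add pol_smult)

lemma pol_self_adjoint: "inn (pol p x) y = inn x (pol p y)"
proof (induction p arbitrary: y)
  case (pCons a p)
  have "inn (P (pol p x)) y = inn x (P (pol p y))"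
    using pCons.IH[of "P y"] self_adjoint[of "pol p x" y] by (simp add: pol_P)
  then show ?case by (simp add: inn_simps)
qed simp

lemma pol_linear_factor_twice:
  assumes "pol [:-a, 1:] (pol [:-a, 1:] y) = 0"
  shows "pol [:-a, 1:] y = 0"
  using pol_self_adjoint[of "[:-a, 1:]" y "pol [:-a, 1:] y"] assms
    inn_self_eq_0[of "pol [:-a, 1:] y"] by (simp del: pol_pCons)

lemma pol_quadratic_injective:
  assumes "pol ([:-a, 1:] * [:-a, 1:] + [:b\<^sup>2:]) y = 0" "b \<noteq> 0"
  shows "y = 0"
proof -
  let ?z = "pol [:-a, 1:] y"
  have "pol [:-a, 1:] ?z + s (of_real (b\<^sup>2)) y = 0"
    using assms(1) by (simp only: pol_add pol_mult) (simp add: P.zero)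
  then have "inn (pol [:-a, 1:] ?z) y + b\<^sup>2 * inn y y = 0"
    by (metis (no_types, lifting) UNIV_I inn_add_left inn_scale_left inn_zero_left to_complex_of_real)
  then have "inn ?z ?z + b\<^sup>2 * inn y y = 0"
    by (simp only: pol_self_adjoint[of _ ?z])
  then have "Re (inn ?z ?z + of_real (b\<^sup>2) * inn y y) = 0"
    by (simp only: zero_complex.sel)
  then have "Re (inn ?z ?z) + b\<^sup>2 * Re (inn y y) = 0"
    by (simp del: pol_pCons of_real_power)
  moreover have "Re (inn ?z ?z) \<ge> 0" "b\<^sup>2 * Re (inn y y) \<ge> 0"
    by (simp_all add: inn_self_nonneg del: pol_pCons)
  ultimately have "b\<^sup>2 * Re (inn y y) = 0" by linarith
  then show ?thesis
    using assms(2) inn_self_eq_0[of y] by simp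
qed

text \<open>The space has finite dimension over the reals as well, so the vectors \<open>P\<^sup>n x\<close> are linearly
  dependent over the reals.\<close>

lemma exists_annihilating_poly: "\<exists>p. p \<noteq> 0 \<and> pol p x = 0"
proof -
  interpret R: vector_space "\<lambda>r. s (of_real r)"
    by unfold_locales (simp_all add: algebra_simps)
  obtain B where B: "finite B" "span B = UNIV"
    using finite_spanning by metis
  obtain i :: 'k where i: "\<And>c. \<exists>a b. c = of_real a + of_real b * i"
    using scalar_decomposition by metis
  \<comment> \<open>By the decomposition of scalars, B together with its multiples by i spans the
    space over the reals.\<close>
  define B' where "B' = B \<union> s i ` B"
  have smul: "s c b \<in> R.span B'" if b: "b \<in> B" for c b
  proof -
    obtain u v where c: "c = of_real u + of_real v * i" using i by blast
    have "s (of_real u) b + s (of_real v) (s i b) \<in> R.span B'"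
      using b by (intro R.span_add R.span_scale R.span_base) (auto simp: B'_def)
    then show ?thesis by (simp add: c scale_left_distrib)
  qed
  have "x \<in> R.span B'" for x
  proof -
    obtain u where "x = (\<Sum>b\<in>B. s (u b) b)"
      using B span_finite[of B] by auto
    then show ?thesis using smul by (auto intro: R.span_sum)
  qed
  then have span: "A \<subseteq> R.span B'" for A by blast
  have finB': "finite B'" using B by (simp add: B'_def)
  define w where "w n = (P ^^ n) x" for n
  have pol_monom: "pol (monom c n) x = s (of_real c) (w n)" for c n
    by (induction n) (simp_all add: w_def monom_Suc monom_0 P.scale P.zero)
  have pol_sum: "pol (\<Sum>j\<in>J. f j) x = (\<Sum>j\<in>J. pol (f j) x)" for f :: "nat \<Rightarrow> real poly" and J
    by (induction J rule: infinite_finite_induct) (simp_all add: pol_add)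
  \<comment> \<open>Dependence is a property of the set of vectors, so a repetition among the
    \<open>w n\<close> is treated separately; it gives a difference of two monomials.\<close>
  show ?thesis
  proof (cases "inj w")
    case False
    then obtain m n where mn: "m \<noteq> n" "w m = w n" by (auto simp: inj_def)
    have "monom 1 m \<noteq> (monom 1 n :: real poly)"
      using mn(1) by (metis degree_monom_eq zero_neq_one)
    moreover have "pol (monom 1 m + monom (-1) n) x = 0"
      using mn(2) by (simp add: pol_add pol_monom)
    moreover have "monom (-1) n = - (monom 1 n :: real poly)" by (simp add: minus_monom)
    ultimately show ?thesis
      by (intro exI[of _ "monom 1 m + monom (-1) n"]) simp
  next
    case True
    then have "infinite (range w)" by (simp add: finite_image_iff)
    then have "R.dependent (range w)"
      using R.independent_span_bound[OF finB' _ span] by blast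
    then obtain T u v where T: "finite T" "T \<subseteq> range w" "(\<Sum>v\<in>T. s (of_real (u v)) v) = 0"
      "v \<in> T" "u v \<noteq> 0"
      unfolding R.dependent_explicit by blast
    then obtain J where J: "finite J" "T = w ` J"
      by (metis finite_subset_image)
    define p where "p = (\<Sum>j\<in>J. monom (u (w j)) j)"
    have "pol p x = (\<Sum>j\<in>J. s (of_real (u (w j))) (w j))"
      unfolding p_def by (simp add: pol_sum pol_monom)
    also have "\<dots> = (\<Sum>v\<in>T. s (of_real (u v)) v)"
      unfolding J(2) using True by (subst sum.reindex) (auto intro: inj_on_subset)
    finally have "pol p x = 0" using T by simp
    moreover obtain j where j: "j \<in> J" "v = w j" using T J by auto
    \<comment> \<open>This nonzero coefficient is what shows that p is not the zero
      polynomial.\<close>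
    have "coeff p j = u v"
      using j J(1) by (simp add: p_def coeff_sum coeff_monom)
    ultimately show ?thesis
      using T(5) by (intro exI[of _ p]) auto
  qed
qed


text \<open>Induction on the degree with x varying: split one factor off p. A nonnegative root is
  collected in A unless it is there already; negative roots and quadratic factors give injective
  operators and are cancelled.\<close>

lemma annihilated_by_distinct_linear_factors:
  assumes pos: "\<And>x. Re (inn (P x) x) \<ge> 0" and "p \<noteq> 0" "pol p x = 0"
  shows "\<exists>A. finite A \<and> A \<subseteq> {0..} \<and> pol (\<Prod>a\<in>A. [:-a, 1:]) x = 0"
  using assms(2,3)
proof (induction "degree p" arbitrary: p x rule: less_induct)
  case less
  show ?case
  proof (cases "degree p = 0")
    case True
    then obtain c where "p = [:c:]" by (rule degree_eq_zeroE)
    then have "x = 0" using less.prems by (simp add: P.zero)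
    then show ?thesis
      by (intro exI[of _ "{}"]) (simp add: one_pCons P.zero)
  next
    case False
    then have "degree p > 0" by simp
    then show ?thesis
    proof (cases rule: real_poly_factor)
      case (1 a q)
      \<comment> \<open>The cofactor q annihilates ?y, so the induction hypothesis is applied to ?y
        in place of x.\<close>
      let ?y = "pol [:-a, 1:] x"
      have q: "q \<noteq> 0" using 1 less.prems by auto
      then have deg: "degree q < degree p"
        unfolding 1 by (subst degree_mult_eq) auto
      have "pol (q * [:-a, 1:]) x = 0"
        using less.prems(2) unfolding 1 by (simp only: mult.commute)
      then have "pol q ?y = 0" by (simp only: pol_mult)
      then obtain A where A: "finite A" "A \<subseteq> {0..}" "pol (\<Prod>a\<in>A. [:-a, 1:]) ?y = 0"
        using less.hyps[OF deg q] by blast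
      show ?thesis
      proof (cases "a \<ge> 0")
        case True
        show ?thesis
        proof (cases "a \<in> A")
          case False
          then have "(\<Prod>a\<in>insert a A. [:-a, 1:]) = (\<Prod>a\<in>A. [:-a, 1:]) * [:-a, 1:]"
            using A(1) by (simp only: prod.insert mult.commute not_False_eq_True)
          then have "pol (\<Prod>a\<in>insert a A. [:-a, 1:]) x = 0"
            using A(3) by (simp only: pol_mult)
          then show ?thesis
            using A True by (intro exI[of _ "insert a A"]) auto
        next
          case mem: True
          \<comment> \<open>Here P - a would be applied twice to \<open>pol w x\<close>;
            self-adjointness lets one copy go.\<close>
          define w where "w = (\<Prod>a\<in>A - {a}. [:-a, 1:])"
          have w: "(\<Prod>a\<in>A. [:-a, 1:]) = [:-a, 1:] * w"
            using A(1) mem unfolding w_def by (rule prod.remove)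
          have "pol ([:-a, 1:] * ([:-a, 1:] * w)) x = 0"
            using A(3) unfolding w by (metis mult.commute pol_mult)
          then have "pol [:-a, 1:] (pol [:-a, 1:] (pol w x)) = 0"
            by (simp only: pol_mult)
          then have "pol (\<Prod>a\<in>A. [:-a, 1:]) x = 0"
            unfolding w pol_mult by (rule pol_linear_factor_twice)
          then show ?thesis using A by blast
        qed
      next
        case False
        have "pol [:-a, 1:] (pol (\<Prod>a\<in>A. [:-a, 1:]) x) = 0"
          using A(3) by (metis mult.commute pol_mult)
        \<comment> \<open>A negative a cannot be an eigenvalue of the nonnegative P, so the factor P
          - a is cancelled.\<close>
        moreover have "y = 0" if "pol [:-a, 1:] y = 0" for y
        proof -
          have "P y = s (of_real a) y"
            using that by (simp add: P.zero add.commute[of _ "P y"] flip: diff_conv_add_uminus)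
          then have "a * Re (inn y y) \<ge> 0"
            using pos[of y] by (simp add: inn_simps)
          then have "Re (inn y y) = 0"
            using False inn_self_nonneg[of y] by (simp add: zero_le_mult_iff)
          then show ?thesis
            using inn_self_eq_0 by simp
        qed
        ultimately show ?thesis using A by blast
      qed
    next
      case (2 a b q)
      have q: "q \<noteq> 0" using 2 less.prems by auto
      have "degree ([:-a, 1:] * [:-a, 1:] + [:b\<^sup>2:]) = 2"
        by simp
      moreover from this have "[:-a, 1:] * [:-a, 1:] + [:b\<^sup>2:] \<noteq> 0"
        by (metis degree_0 zero_neq_numeral)
      ultimately have deg: "degree q < degree p"
        unfolding 2 using q by (subst degree_mult_eq) auto
      have "pol ([:-a, 1:] * [:-a, 1:] + [:b\<^sup>2:]) (pol q x) = 0"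
        using less.prems(2) unfolding 2 by (simp only: pol_mult)
      then have "pol q x = 0"
        using 2(1) by (rule pol_quadratic_injective)
      then show ?thesis using less.hyps[OF deg q] by blast
    qed
  qed
qed

text \<open>The root set found so far depends on the vector. The union over a finite spanning set
  still annihilates each spanning vector, hence by linearity everything.\<close>

lemma annihilated_uniformly:
  assumes "\<And>x. Re (inn (P x) x) \<ge> 0"
  shows "\<exists>A. finite A \<and> A \<subseteq> {0..} \<and> (\<forall>x. pol (\<Prod>a\<in>A. [:-a, 1:]) x = 0)"
proof -
  obtain B where B: "finite B" "span B = UNIV"
    using finite_spanning by metis
  have "\<exists>A. finite A \<and> A \<subseteq> {0..} \<and> pol (\<Prod>a\<in>A. [:-a, 1:]) x = 0" for x
    using exists_annihilating_poly annihilated_by_distinct_linear_factors[OF assms] by metis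
  then obtain F where F: "\<And>x. finite (F x)" "\<And>x. F x \<subseteq> {0..}"
    "\<And>x. pol (\<Prod>a\<in>F x. [:-a, 1:]) x = 0"
    by metis
  define A where "A = (\<Union>b\<in>B. F b)"
  have A: "finite A" "A \<subseteq> {0..}"
    using B F unfolding A_def by auto
  interpret pol: Vector_Spaces.linear s s "pol (\<Prod>a\<in>A. [:-a, 1:])"
    by (rule linear_pol)
  have "pol (\<Prod>a\<in>A. [:-a, 1:]) b = 0" if "b \<in> B" for b
  proof -
    have "F b \<subseteq> A" using that by (auto simp: A_def)
    then have "(\<Prod>a\<in>A. [:-a, 1:]) = (\<Prod>a\<in>A - F b. [:-a, 1:]) * (\<Prod>a\<in>F b. [:-a, 1:])"
      using A(1) by (rule prod.subset_diff)
    then have "pol (\<Prod>a\<in>A. [:-a, 1:]) b = pol (\<Prod>a\<in>A - F b. [:-a, 1:]) 0"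
      by (simp only: pol_mult F(3))
    then show ?thesis
      by simp
  qed
  then have "pol (\<Prod>a\<in>A. [:-a, 1:]) x = 0" for x
    using pol.eq_0_on_span[of B x] unfolding B(2) by blast
  then show ?thesis using A by blast
qed

text \<open>The polynomial r^4 - X vanishes on A, so the annihilating product divides it and it
  vanishes at P. Fourth roots are used so that the square root r(P)^2 is positive at sight: its
  quadratic form is |r(P) x|^2.\<close>

lemma positive_fourth_root:
  assumes "\<And>x. Re (inn (P x) x) \<ge> 0"
  shows "\<exists>r. \<forall>x. pol r (pol r (pol r (pol r x))) = P x"
proof -
  obtain A where A: "finite A" "A \<subseteq> {0..}" "\<And>x. pol (\<Prod>a\<in>A. [:-a, 1:]) x = 0"
    using annihilated_uniformly[OF assms] by metis
  obtain r where r: "\<And>a. a \<in> A \<Longrightarrow> poly r a = root 4 a"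
    using interpolation_poly[OF A(1)] by metis
  have "(\<Prod>a\<in>A. [:-a, 1:]) dvd (r ^ 4 - [:0, 1:])"
  proof (rule prod_linear_dvd[OF A(1)])
    fix a assume a: "a \<in> A"
    then have "root 4 a ^ 4 = a"
      using A(2) by (intro real_root_pow_pos2) auto
    then show "poly (r ^ 4 - [:0, 1:]) a = 0"
      using r[OF a] by simp
  qed
  then obtain g where g: "r ^ 4 - [:0, 1:] = g * (\<Prod>a\<in>A. [:-a, 1:])"
    by (metis dvdE mult.commute)
  have "pol (r ^ 4) x = P x" for x
  proof -
    have "pol (g * (\<Prod>a\<in>A. [:-a, 1:])) x = 0"
      by (simp only: pol_mult A(3)) (induction g; simp add: P.zero)
    then have "pol ([:0, 1:] + (r ^ 4 - [:0, 1:])) x = pol [:0, 1:] x"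
      by (simp only: pol_add g) simp
    then show ?thesis by (simp add: P.zero)
  qed
  then show ?thesis
    by (intro exI[of _ r]) (simp add: numeral_eq_Suc pol_mult)
qed

end

section \<open>Existence and uniqueness of the positive square root\<close>

context fd_hilbert_UNIV
begin

text \<open>The quadratic form of Q at y + t Q y is 2 t |Q y|^2 + t^2 q. It is nonnegative for all
  real t, which forces its linear coefficient to vanish.\<close>

lemma positive_op_kernel:
  assumes Q: "positive_op s ip Q" and 0: "Re (inn (Q y) y) = 0"
  shows "Q y = 0"
proof -
  interpret Q: Vector_Spaces.linear s s Q
    using Q by (simp add: positive_op_def bounded_op_def)
  have sa: "inn (Q x) z = inn x (Q z)" and pos: "Re (inn (Q x) x) \<ge> 0" for x z
    using Q by (auto simp: positive_op_def)
  let ?n = "Re (inn (Q y) (Q y))" and ?q = "Re (inn (Q (Q y)) (Q y))"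
  have quad: "2 * t * ?n + t\<^sup>2 * ?q \<ge> 0" for t :: real
  proof -
    have "Re (inn (Q (y + s (of_real t) (Q y))) (y + s (of_real t) (Q y))) = 2 * t * ?n + t\<^sup>2 * ?q"
      using 0 sa[of "Q y" y] by (simp add: Q.add Q.scale inn_simps algebra_simps power2_eq_square)
    then show ?thesis using pos by metis
  qed
  have "?q \<ge> 0" "?n \<ge> 0"
    using pos inn_self_nonneg by auto
  have "?n = 0"
  proof (rule ccontr)
    assume "?n \<noteq> 0"
    then have n: "?n > 0" using \<open>?n \<ge> 0\<close> by simp
    \<comment> \<open>The summand 1 keeps the denominator positive when ?q = 0; the form then takes
      the negative value t (?n - t).\<close>
    define t where "t = - ?n / (?q + 1)"
    have t: "t < 0" "t * (?q + 1) = - ?n"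
      using n \<open>?q \<ge> 0\<close> by (auto simp: t_def divide_neg_pos)
    have "2 * t * ?n + t\<^sup>2 * ?q = t * (2 * ?n + (t * (?q + 1) - t))"
      by (simp add: algebra_simps power2_eq_square)
    also have "\<dots> = t * (?n - t)"
      unfolding t(2) by simp
    also have "\<dots> < 0"
      using t(1) n by (simp add: mult_neg_pos)
    finally show False using quad[of t] by simp
  qed
  then show ?thesis using inn_self_eq_0 by simp
qed

text \<open>The square root is taken as \<open>r(P)\<^sup>2\<close> with \<open>r\<close> a real polynomial.  Any other root
  commutes with \<open>P\<close>, hence with this one.\<close>

lemma ex1_sqrt_op:
  assumes P: "positive_op s ip P"
  shows "\<exists>!R. positive_op s ip R \<and> R \<circ> R = P"
proof -
  interpret self_adjoint s ip P
    using P by unfold_locales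
      (auto simp: positive_op_def bounded_op_def Vector_Spaces.linear_iff)
  have "Re (inn (P x) x) \<ge> 0" for x
    using P unfolding positive_op_def by blast
  then obtain r where r: "\<And>x. pol r (pol r (pol r (pol r x))) = P x"
    using positive_fourth_root by metis
  define R where "R = (\<lambda>x. pol r (pol r x))"
  have linR: "Vector_Spaces.linear s s R"
    using Vector_Spaces.linear_compose[OF linear_pol linear_pol] by (simp add: R_def o_def)
  have R: "positive_op s ip R"
    unfolding positive_op_def
  proof (intro conjI allI)
    show "bounded_op s ip s UNIV ip R"
      by (rule linear_imp_bounded_op[OF fd_hilbert linR]) simp
    show "ip (R x) y = ip x (R y)" for x y
      using pol_self_adjoint[of r "pol r x" y] pol_self_adjoint[of r x "pol r y"] by (simp add: R_def)
    show "Re (inn (R x) x) \<ge> 0" for x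
      using pol_self_adjoint[of r "pol r x" x] inn_self_nonneg[of "pol r x"] by (simp add: R_def)
  qed
  have RR: "R (R x) = P x" for x
    by (simp add: R_def r)
  have "R' = R" if R': "positive_op s ip R'" and R'R': "R' \<circ> R' = P" for R'
  proof
    fix x
    interpret R': Vector_Spaces.linear s s R'
      using R' by (simp add: positive_op_def bounded_op_def)
    interpret R: Vector_Spaces.linear s s R by (rule linR)
    have R'2: "R' (R' x) = P x" for x
      using R'R' by (simp add: fun_eq_iff)
    then have "R' (P x) = P (R' x)" for x
      by metis
    then have comm: "R' (R x) = R (R' x)" for x
      by (simp add: R_def pol_commute[OF R'.linear_axioms])
    \<comment> \<open>Since the roots commute, (R + R') y = R^2 x - R'^2 x = 0. Both quadratic forms
      are nonnegative, so both vanish at y, and the kernel lemma gives R y = R' y = 0.\<close>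
    define y where "y = R x - R' x"
    have "R y + R' y = 0"
      by (simp add: y_def R.diff R'.diff RR R'2 comm)
    then have "inn (R y + R' y) y = 0" by simp
    then have "Re (inn (R y) y) + Re (inn (R' y) y) = 0"
      by (metis (no_types) UNIV_I inn_add_left plus_complex.sel(1) zero_complex.sel(1))
    moreover have "Re (inn (R y) y) \<ge> 0" "Re (inn (R' y) y) \<ge> 0"
      using R R' by (auto simp: positive_op_def)
    ultimately have "R y = 0" "R' y = 0"
      using positive_op_kernel[OF R, of y] positive_op_kernel[OF R', of y] by auto
    have "inn y y = inn (R x) y - inn (R' x) y"
      by (subst (1) y_def) (simp add: inn_simps)
    also have "\<dots> = inn x (R y) - inn x (R' y)"
      using R R' by (simp add: positive_op_def)
    also have "\<dots> = 0"
      by (simp add: \<open>R y = 0\<close> \<open>R' y = 0\<close>)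
    finally have "y = 0" using inn_self_eq_0[of y] by simp
    then show "R' x = R x" by (simp add: y_def)
  qed
  moreover have "R \<circ> R = P"
    by (simp add: fun_eq_iff RR)
  ultimately show ?thesis
    using R by blast
qed

lemma
  assumes "positive_op s ip P"
  shows positive_sqrt_op: "positive_op s ip (sqrt_op s ip P)"
    and sqrt_op_sqrt_op: "sqrt_op s ip P (sqrt_op s ip P x) = P x"
  using theI'[OF ex1_sqrt_op[OF assms]] by (auto simp: sqrt_op_def fun_eq_iff)

text \<open>Substituting u for \<open>inv S x\<close> turns each condition on the inverse into the
  corresponding one on S. This makes the square root of the inverse available.\<close>

lemma positive_inv:
  assumes S: "positive_op s ip S" and "bij S"
  shows "positive_op s ip (inv S)"
proof -
  interpret S: Vector_Spaces.linear s s S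
    using S by (simp add: positive_op_def bounded_op_def)
  have S_inv [simp]: "S (inv S x) = x" "inv S (S x) = x" for x
    using \<open>bij S\<close> by (simp_all add: bij_is_surj surj_f_inv_f bij_is_inj inv_f_f)
  have lin: "Vector_Spaces.linear s s (inv S)"
    unfolding Vector_Spaces.linear_iff
  proof (intro conjI allI)
    show "inv S (x + y) = inv S x + inv S y" for x y
      by (metis S.add S_inv)
    show "inv S (s c x) = s c (inv S x)" for c x
      by (metis S.scale S_inv)
  qed (rule vector_space_axioms)+
  have sa: "ip (S x) y = ip x (S y)" and pos: "Re (inn (S x) x) \<ge> 0" for x y
    using S by (auto simp: positive_op_def)
  show ?thesis
    unfolding positive_op_def
  proof (intro conjI allI)
    show "bounded_op s ip s UNIV ip (inv S)"
      by (rule linear_imp_bounded_op[OF fd_hilbert lin]) simp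
    show "ip (inv S x) y = ip x (inv S y)" for x y
      using sa[of "inv S x" "inv S y"] by simp
    show "Re (inn (inv S x) x) \<ge> 0" for x
      using pos[of "inv S x"] sa[of "inv S x" "inv S x"] by simp
  qed
qed

end

section \<open>Frames\<close>

context fd_hilbert_UNIV
begin

lemma positive_frame_op:
  assumes hil: "\<And>j. j \<in> {1..m} \<Longrightarrow> fd_hilbert_space t (K j) (iq j)"
    and V: "\<And>j. j \<in> {1..m} \<Longrightarrow> bounded_op s ip t (K j) (iq j) (V j)"
  shows "positive_op s ip (frame_op ip iq m V)"
proof -
  let ?S = "frame_op ip iq m V"
  have S: "inn z (?S x) = (\<Sum>j=1..m. to_complex (iq j (V j z) (V j x)))" for z x
    using hil V by (rule frame_op)
  have VK: "V j x \<in> K j" if "j \<in> {1..m}" for j x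
    using V[OF that] by (auto simp: bounded_op_def)
  have sa: "inn (?S x) y = inn x (?S y)" for x y
  proof -
    have "inn (?S x) y = cnj (\<Sum>j=1..m. to_complex (iq j (V j y) (V j x)))"
      using inn_commute[of y "?S x"] S[of y x] by simp
    also have "\<dots> = (\<Sum>j=1..m. to_complex (iq j (V j x) (V j y)))"
      unfolding cnj_sum
    proof (rule sum.cong)
      fix j assume j: "j \<in> {1..m}"
      interpret Y: fd_hilbert t "K j" "iq j" by unfold_locales (rule hil[OF j])
      show "cnj (to_complex (iq j (V j y) (V j x))) = to_complex (iq j (V j x) (V j y))"
        using Y.inn_commute[OF VK[OF j] VK[OF j], of y x] by simp
    qed simp
    also have "\<dots> = inn x (?S y)"
      by (rule S[symmetric])
    finally show ?thesis .
  qed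
  \<comment> \<open>Linearity is read off from self-adjointness: paired with z, the image of x
    becomes the inner product of \<open>?S z\<close> with x.\<close>
  have lin: "Vector_Spaces.linear s s ?S"
    unfolding Vector_Spaces.linear_iff
  proof (intro conjI allI)
    show "?S (x + y) = ?S x + ?S y" for x y
      by (rule inn_eqI) (simp add: inn_simps flip: sa)
    show "?S (s c x) = s c (?S x)" for c x
      by (rule inn_eqI) (simp add: inn_simps flip: sa)
  qed (rule vector_space_axioms)+
  show ?thesis
    unfolding positive_op_def
  proof (intro conjI allI)
    show "bounded_op s ip s UNIV ip ?S"
      by (rule linear_imp_bounded_op[OF fd_hilbert lin]) simp
    show "ip (?S x) y = ip x (?S y)" for x y
      using sa by simp
    show "Re (inn (?S x) x) \<ge> 0" for x
      unfolding sa S Re_sum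
    proof (rule sum_nonneg)
      fix j assume j: "j \<in> {1..m}"
      interpret Y: fd_hilbert t "K j" "iq j" by unfold_locales (rule hil[OF j])
      show "Re (to_complex (iq j (V j x) (V j x))) \<ge> 0"
        by (rule Y.inn_self_nonneg[OF VK[OF j]])
    qed
  qed
qed

lemma op_le_refl: "op_le s ip P P"
proof -
  have "Vector_Spaces.linear s s (\<lambda>x. 0)"
    by (simp add: Vector_Spaces.linear_iff vector_space_axioms)
  then have "bounded_op s ip s UNIV ip (\<lambda>x. 0)"
    by (intro linear_imp_bounded_op[OF fd_hilbert]) auto
  moreover have "ip 0 y = 0 \<and> ip y 0 = 0" for y
    using inn_zero_left[of y] inn_zero_right[of y] by (simp del: inn_zero_left inn_zero_right)
  ultimately show ?thesis
    by (simp add: op_le_def positive_op_def)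
qed

end

theorem theorem9:
  fixes s :: "'k::real_or_complex \<Rightarrow> 'h::ab_group_add \<Rightarrow> 'h"
    and ip :: "'h \<Rightarrow> 'h \<Rightarrow> 'k"
    and t :: "'k \<Rightarrow> 'g::ab_group_add \<Rightarrow> 'g"
    and K :: "nat \<Rightarrow> 'g set"
    and iq :: "nat \<Rightarrow> 'g \<Rightarrow> 'g \<Rightarrow> 'k"
    and m :: nat
    and V W :: "nat \<Rightarrow> 'h \<Rightarrow> 'g"
  assumes "fd_hilbert_space s UNIV ip"
    and "\<And>j. j \<in> {1..m} \<Longrightarrow> fd_hilbert_space t (K j) (iq j)"
    and "opv_frame s ip t K iq m V"
    and "opv_frame s ip t K iq m W"
    and "similar_opv s ip m V W"
    and "equal_norm s ip iq m W"
    and "tight_opv_frame s ip t K iq m W"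
  defines "S \<equiv> frame_op ip iq m V"
  shows "equal_norm s ip iq m (\<lambda>j. V j \<circ> inv_sqrt_op s ip S) \<and>
         parseval_opv_frame s ip t K iq m (\<lambda>j. V j \<circ> inv_sqrt_op s ip S)"
proof -
  interpret H: fd_hilbert_UNIV s ip
    using assms(1) by (simp add: fd_hilbert_UNIV_iff)
  note hil = assms(2)
  have V: "\<And>j. j \<in> {1..m} \<Longrightarrow> bounded_op s ip t (K j) (iq j) (V j)"
    and W: "\<And>j. j \<in> {1..m} \<Longrightarrow> bounded_op s ip t (K j) (iq j) (W j)"
    using assms(3,4) by (auto simp: opv_frame_def)
  obtain T T' where T: "bounded_op s ip s UNIV ip T" and T': "bounded_op s ip s UNIV ip T'"
    and TT': "\<And>x. T (T' x) = x" "\<And>x. T' (T x) = x" and VW: "\<And>j. j \<in> {1..m} \<Longrightarrow> V j = W j \<circ> T"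
    using assms(5) unfolding similar_opv_def invertible_op_def
    by (metis comp_apply id_apply)
  interpret T: Vector_Spaces.linear s s T
    using T by (simp add: bounded_op_def)
  obtain A where A: "A > 0" and WA: "frame_op ip iq m W = s (of_real A)"
    using assms(7) by (auto simp: tight_opv_frame_def)
  obtain c where c: "c > 0" and Wc: "\<And>j. j \<in> {1..m} \<Longrightarrow> hs_norm s ip (iq j) (W j) = c"
    using assms(6) by (auto simp: equal_norm_def)
  have S_V: "H.inn z (S x) = (\<Sum>j=1..m. to_complex (iq j (V j z) (V j x)))" for z x
    unfolding S_def using hil V by (rule H.frame_op)
  \<comment> \<open>Substituting V_j = W_j T turns the form of S into that of the frame operator of
    W, taken at T z and T x; the latter operator is A times the identity.\<close>
  have S_T: "H.inn z (S x) = A * H.inn (T z) (T x)" for z x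
  proof -
    have "H.inn z (S x) = (\<Sum>j=1..m. to_complex (iq j (W j (T z)) (W j (T x))))"
      unfolding S_V by (intro sum.cong) (auto simp: VW)
    also have "\<dots> = H.inn (T z) (frame_op ip iq m W (T x))"
      using hil W by (rule H.frame_op[symmetric])
    also have "\<dots> = A * H.inn (T z) (T x)"
      by (simp add: WA H.inn_simps)
    finally show ?thesis .
  qed
  have S: "positive_op s ip S"
    unfolding S_def using hil V by (rule H.positive_frame_op)
  then interpret S: Vector_Spaces.linear s s S
    by (simp add: positive_op_def bounded_op_def)
  have "bij S"
  proof (rule bijI)
    have "x = 0" if "S x = 0" for x
    proof -
      have "H.inn (T x) (T x) = 0"
        using S_T[of x x] A that by simp
      then have "T x = 0" using H.inn_self_eq_0[of "T x"] by simp
      then show ?thesis using TT'(2)[of x] TT'(2)[of 0] T.zero by simp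
    qed
    then show "inj S" by (simp add: S.inj_iff_eq_0)
    \<comment> \<open>As S is A times the adjoint of T composed with T, its inverse is 1/A times T'
      composed with the adjoint of T'.\<close>
    have "S (s (of_real (1 / A)) (T' (adj_op ip ip T' x))) = x" for x
    proof (rule H.inn_eqI)
      fix z
      have "H.inn (T z) (adj_op ip ip T' x) = H.inn z x"
        using T' H.adj_op[OF assms(1), of T' x "T z"] by (simp add: bounded_op_def TT')
      then show "H.inn z (S (s (of_real (1 / A)) (T' (adj_op ip ip T' x)))) = H.inn z x"
        using A by (simp add: S_T T.scale TT' H.inn_simps del: of_real_divide flip: of_real_mult)
    qed
    then show "surj S" by (rule surjI)
  qed
  define R where "R = inv_sqrt_op s ip S"
  have P: "positive_op s ip (inv S)"
    by (rule H.positive_inv[OF S \<open>bij S\<close>])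
  have R: "positive_op s ip R"
    unfolding R_def inv_sqrt_op_def by (rule H.positive_sqrt_op[OF P])
  interpret R: Vector_Spaces.linear s s R
    using R by (simp add: positive_op_def bounded_op_def)
  have RR: "R (R x) = inv S x" for x
    unfolding R_def inv_sqrt_op_def by (rule H.sqrt_op_sqrt_op[OF P])
  have RRS: "R (R (S x)) = x" and SRR: "S (R (R x)) = x" for x
    using \<open>bij S\<close> by (simp_all add: RR bij_is_inj inv_f_f bij_is_surj surj_f_inv_f)
  \<comment> \<open>\<open>SRR\<close> at \<open>R (S x)\<close> together with \<open>RRS\<close>
    shows that S and R commute, which reduces the claim to \<open>RRS\<close>.\<close>
  have RSR: "R (S (R x)) = x" for x
    using SRR[of "R (S x)"] by (metis RRS SRR)
  have R_sa: "ip (R x) y = ip x (R y)" for x y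
    using R by (simp add: positive_op_def)
  define U where "U = (\<lambda>x. s (of_real (sqrt A)) (T (R x)))"
  have linU: "Vector_Spaces.linear s s U"
    unfolding U_def Vector_Spaces.linear_iff
    by (simp add: H.vector_space_axioms R.add T.add R.scale T.scale H.scale_right_distrib mult.commute)
  \<comment> \<open>The preimage is found by undoing the scaling, then T, then R, whose inverse is R
    S by \<open>RRS\<close>.\<close>
  have "U (R (S (T' (s (of_real (1 / sqrt A)) x)))) = x" for x
    using A by (simp add: U_def RRS TT' del: of_real_divide flip: of_real_mult)
  then have "surj U" by (rule surjI)
  have U_iso: "ip (U x) (U y) = ip x y" for x y
  proof -
    have "H.inn (U x) (U y) = A * H.inn (T (R x)) (T (R y))"
      using A by (simp add: U_def H.inn_simps flip: of_real_mult mult.assoc)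
    also have "\<dots> = H.inn x (R (S (R y)))"
      by (simp add: R_sa flip: S_T)
    finally show ?thesis by (simp add: RSR)
  qed
  obtain E where E: "orthonormal_basis s ip E"
    using H.exists_orthonormal_basis by blast
  have VR: "Vector_Spaces.linear s t (V j \<circ> R)" "range (V j \<circ> R) \<subseteq> K j" if "j \<in> {1..m}" for j
    using V[OF that] Vector_Spaces.linear_compose[OF R.linear_axioms, of t "V j"]
    by (auto simp: bounded_op_def)
  have "hs_norm s ip (iq j) (V j \<circ> R) = c / sqrt A" if j: "j \<in> {1..m}" for j
  proof -
    interpret Y: fd_hilbert t "K j" "iq j" by unfold_locales (rule hil[OF j])
    have linW: "Vector_Spaces.linear s t (W j)" and WK: "range (W j) \<subseteq> K j"
      using W[OF j] by (auto simp: bounded_op_def)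
    interpret W: Vector_Spaces.linear s t "W j" by (rule linW)
    have norm: "ip_norm (iq j) (W j (U x)) = sqrt A * ip_norm (iq j) ((V j \<circ> R) x)" for x
    proof -
      have "W j (T (R x)) \<in> K j" using WK by auto
      then show ?thesis
        using A by (simp add: U_def W.scale VW[OF j] Y.ip_norm_scale)
    qed
    have "c = sqrt (\<Sum>e\<in>U ` E. (ip_norm (iq j) (W j e))\<^sup>2)"
      using Wc[OF j]
        H.hs_norm_eq[OF H.orthonormal_basis_image(1)[OF E linU \<open>surj U\<close> U_iso] hil[OF j] linW WK]
      by simp
    also have "\<dots> = sqrt (\<Sum>e\<in>E. (ip_norm (iq j) (W j (U e)))\<^sup>2)"
      by (simp add: sum.reindex[OF H.orthonormal_basis_image(2)[OF E linU \<open>surj U\<close> U_iso]])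
    also have "\<dots> = sqrt (A * (\<Sum>e\<in>E. (ip_norm (iq j) ((V j \<circ> R) e))\<^sup>2))"
      unfolding norm using A by (simp add: power_mult_distrib sum_distrib_left)
    also have "\<dots> = sqrt A * hs_norm s ip (iq j) (V j \<circ> R)"
      unfolding H.hs_norm_eq[OF E hil[OF j] VR[OF j]] by (rule real_sqrt_mult)
    finally show ?thesis using A by (simp add: field_simps)
  qed
  then have "equal_norm s ip iq m (\<lambda>j. V j \<circ> R)"
    using c A unfolding equal_norm_def by (intro exI[of _ "c / sqrt A"]) simp
  moreover have "parseval_opv_frame s ip t K iq m (\<lambda>j. V j \<circ> R)"
  proof -
    have VRb: "bounded_op s ip t (K j) (iq j) (V j \<circ> R)" if "j \<in> {1..m}" for j
      by (rule H.linear_imp_bounded_op[OF hil[OF that] VR[OF that]])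
    \<comment> \<open>The form of the new frame operator at z and x is that of S at R z and R x, so
      this operator is R S R.\<close>
    have "frame_op ip iq m (\<lambda>j. V j \<circ> R) x = x" for x
    proof (rule H.inn_eqI)
      fix z
      have "H.inn z (frame_op ip iq m (\<lambda>j. V j \<circ> R) x) = H.inn (R z) (S (R x))"
        unfolding S_V using H.frame_op[of m t K iq "\<lambda>j. V j \<circ> R", OF hil VRb] by simp
      then show "H.inn z (frame_op ip iq m (\<lambda>j. V j \<circ> R) x) = H.inn z x"
        by (simp add: R_sa RSR)
    qed
    then have id: "frame_op ip iq m (\<lambda>j. V j \<circ> R) = id"
      by (simp add: fun_eq_iff)
    \<comment> \<open>Both frame bounds are taken to be 1, so both operator inequalities become
      reflexivity.\<close>
    have "s (of_real 1) = id"
      by (simp add: fun_eq_iff)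
    then have "op_le s ip (s (of_real 1)) id" "op_le s ip id (s (of_real 1))"
      using H.op_le_refl by simp_all
    then show ?thesis
      unfolding parseval_opv_frame_def opv_frame_def id using VRb zero_less_one by blast
  qed
  ultimately show ?thesis
    unfolding R_def by blast
qed

end
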